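(* Let $n$ be a positive integer. Every surjective contractive Schur multiplicative linear map $T: M_n\to M_n$ is an isometry.
   Context: $M_n$ is the space of $n\times n$ complex matrices, equipped with the operator norm (as operators on the Hilbert space $\mathbb{C}^n$). For $a=[a_{ij}]$, $b=[b_{ij}]$ in $M_n$, the Schur product is the entrywise product $a\ast b=[a_{ij}b_{ij}]$. A linear map $T$ on $M_n$ is Schur multiplicative if $T(a)\ast T(b)=T(a\ast b)$ for all $a,b\in M_n$. $T$ is contractive if its operator norm as a linear map on the normed space $M_n$ satisfies $\|T\|_{\mathrm{op}}\le 1$. *)

theory Defs
  imports "HOL-Analysis.Analysis"
begin

text \<open>
  The algebra \<open>M\<^sub>n\<close> is \<^typ>\<open>complex^'n^'n\<close> with \<open>n = CARD('n)\<close>. The norm that the library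
  attaches to this type is the Frobenius norm, not the operator norm, so the norms on
  \<open>M\<^sub>n\<close> and on maps of \<open>M\<^sub>n\<close> are introduced separately. On \<^typ>\<open>complex^'n\<close> the library
  norm is the Hilbert space norm.
\<close>

type_synonym 'n cmat = "complex^'n^'n"

definition opnorm :: "'n::finite cmat \<Rightarrow> real" where
  "opnorm a = onorm (\<lambda>x :: complex^'n. a *v x)"

definition schur_prod :: "'n::finite cmat \<Rightarrow> 'n cmat \<Rightarrow> 'n cmat" where
  "schur_prod a b = (\<chi> i j. a $ i $ j * b $ i $ j)"

definition cmat_scale :: "complex \<Rightarrow> 'n::finite cmat \<Rightarrow> 'n cmat" where
  "cmat_scale c a = (\<chi> i j. c * a $ i $ j)"

lemma vector_space_cmat_scale: "vector_space (cmat_scale :: complex \<Rightarrow> 'n::finite cmat \<Rightarrow> 'n cmat)"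
  by unfold_locales (simp_all add: cmat_scale_def vec_eq_iff algebra_simps)

definition clinear_map :: "('n::finite cmat \<Rightarrow> 'n cmat) \<Rightarrow> bool" where
  "clinear_map T \<longleftrightarrow> Vector_Spaces.linear cmat_scale cmat_scale T"

definition schur_multiplicative :: "('n::finite cmat \<Rightarrow> 'n cmat) \<Rightarrow> bool" where
  "schur_multiplicative T \<longleftrightarrow> (\<forall>a b. schur_prod (T a) (T b) = T (schur_prod a b))"

text \<open>
  Same formula as \<^const>\<open>onorm\<close>, with \<^const>\<open>opnorm\<close> in place of the library norm. The
  supremum is over a bounded set whenever \<open>T\<close> is linear, since \<open>M\<^sub>n\<close> is finite-dimensional;
  the term for \<open>a = 0\<close> is \<open>0 / 0 = 0\<close>.
\<close>

definition map_opnorm :: "('n::finite cmat \<Rightarrow> 'n cmat) \<Rightarrow> real" where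
  "map_opnorm T = (SUP a. opnorm (T a) / opnorm a)"

definition contractive :: "('n::finite cmat \<Rightarrow> 'n cmat) \<Rightarrow> bool" where
  "contractive T \<longleftrightarrow> map_opnorm T \<le> 1"

definition opnorm_isometry :: "('n::finite cmat \<Rightarrow> 'n cmat) \<Rightarrow> bool" where
  "opnorm_isometry T \<longleftrightarrow> (\<forall>a b. opnorm (T a - T b) = opnorm (a - b))"

end

theory Submission
  imports Defs
begin

text \<open>
  The Schur idempotents are exactly the matrices with all entries 0 or 1, so there are only
  finitely many of them, and a Schur multiplicative map sends them to one another. They contain
  the matrix units and hence span \<open>M\<^sub>n\<close>, so a power of \<open>T\<close> is determined by what it does to them.
  By the pigeonhole principle two different powers of \<open>T\<close> are the same map. A surjective linear
  map is injective in finite dimension, so the smaller power can be cancelled and \<open>T\<close> has finite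
  order: \<open>T\<^sup>k = id\<close> for some \<open>k > 0\<close> (lemma \<open>schur_multiplicative_inj_finite_order\<close>).

  The inverse of a contractive such \<open>T\<close> is therefore the power \<open>k - 1\<close> of a contraction, hence itself
  a contraction, and an invertible contraction with contractive inverse is an isometry.
\<close>

lemma norm_matrix_vector_mult_le:
  fixes a :: "'n::finite cmat"
  shows "norm (a *v x) \<le> (real CARD('n))\<^sup>2 * norm a * norm x"
proof -
  have "norm (a *v x) \<le> (\<Sum>i\<in>UNIV. norm ((a *v x) $ i))"
    by (simp add: norm_vec_def L2_set_le_sum)
  also have "\<dots> \<le> (\<Sum>i\<in>(UNIV::'n set). \<Sum>j\<in>(UNIV::'n set). norm a * norm x)"
  proof (rule sum_mono)
    fix i
    have "norm (a $ i $ j * x $ j) \<le> norm a * norm x" for j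
      unfolding norm_mult
      by (intro mult_mono order_trans[OF Finite_Cartesian_Product.norm_nth_le]
            Finite_Cartesian_Product.norm_nth_le) auto
    then show "norm ((a *v x) $ i) \<le> (\<Sum>j\<in>(UNIV::'n set). norm a * norm x)"
      by (simp only: matrix_vector_mult_def vec_lambda_beta) (rule sum_norm_le)
  qed
  finally show ?thesis
    by (simp add: power2_eq_square algebra_simps)
qed

lemma opnorm_nonneg: "0 \<le> opnorm a"
  unfolding opnorm_def by (rule onorm_pos_le[OF matrix_vector_mul_bounded_linear])

lemma opnorm_le_norm: "opnorm (a :: 'n::finite cmat) \<le> (real CARD('n))\<^sup>2 * norm a"
  unfolding opnorm_def
  by (rule onorm_bound) (simp_all add: norm_matrix_vector_mult_le)

lemma norm_entry_le_opnorm: "norm (a $ i $ j) \<le> opnorm (a :: 'n::finite cmat)"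
proof -
  have "a $ i $ j = (a *v axis j 1) $ i"
    by (simp add: matrix_vector_mult_def axis_def if_distrib cong: if_cong)
  also have "norm \<dots> \<le> norm (a *v axis j 1)"
    by (rule Finite_Cartesian_Product.norm_nth_le)
  also have "\<dots> \<le> opnorm a * norm (axis j 1 :: complex^'n)"
    unfolding opnorm_def by (rule onorm[OF matrix_vector_mul_bounded_linear])
  finally show ?thesis by simp
qed

lemma norm_le_opnorm: "norm (a :: 'n::finite cmat) \<le> (real CARD('n))\<^sup>2 * opnorm a"
proof -
  have "norm (a $ i) \<le> (\<Sum>j\<in>UNIV. norm (a $ i $ j))" for i
    by (simp add: norm_vec_def L2_set_le_sum)
  then have "norm a \<le> (\<Sum>i\<in>UNIV. \<Sum>j\<in>UNIV. norm (a $ i $ j))"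
    unfolding norm_vec_def[of a]
    by (intro order_trans[OF L2_set_le_sum] sum_mono) auto
  also have "\<dots> \<le> (\<Sum>i\<in>(UNIV::'n set). \<Sum>j\<in>(UNIV::'n set). opnorm a)"
    by (intro sum_mono norm_entry_le_opnorm)
  finally show ?thesis by (simp add: power2_eq_square algebra_simps)
qed

lemma clinear_map_imp_linear:
  assumes "clinear_map T" shows "linear T"
proof -
  interpret Vector_Spaces.linear cmat_scale cmat_scale T
    using assms by (simp add: clinear_map_def)
  have "r *\<^sub>R a = cmat_scale (complex_of_real r) a" for r and a :: "'a cmat"
    by (simp add: cmat_scale_def vec_eq_iff scaleR_conv_of_real[symmetric])
  then show ?thesis
    by (intro linearI) (simp_all add: add scale)
qed

lemma clinear_map_funpow: "clinear_map T \<Longrightarrow> clinear_map (T ^^ k)"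
  unfolding clinear_map_def
proof (induction k)
  case 0
  show ?case
    using vector_space.linear_id[OF vector_space_cmat_scale] by (simp add: id_def)
next
  case (Suc k)
  then show ?case
    unfolding funpow.simps(2) by (intro Vector_Spaces.linear_compose)
qed

lemma clinear_map_eqI_units:
  fixes f g :: "'n::finite cmat \<Rightarrow> 'n cmat"
  assumes f: "clinear_map f" and g: "clinear_map g"
    and eq: "\<And>i j. f (axis i (axis j 1)) = g (axis i (axis j 1))"
  shows "f = g"
proof
  fix a :: "'n cmat"
  have expand: "h a = (\<Sum>i\<in>UNIV. \<Sum>j\<in>UNIV. cmat_scale (a $ i $ j) (h (axis i (axis j 1))))"
    if "clinear_map h" for h :: "'n cmat \<Rightarrow> 'n cmat"
  proof -
    interpret Vector_Spaces.linear cmat_scale cmat_scale h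
      using that by (simp add: clinear_map_def)
    have "a = (\<Sum>i\<in>UNIV. \<Sum>j\<in>UNIV. cmat_scale (a $ i $ j) (axis i (axis j 1)))"
    proof (intro vec_eq_iff[THEN iffD2] allI)
      fix k l
      have "(\<Sum>i\<in>UNIV. \<Sum>j\<in>UNIV. cmat_scale (a $ i $ j) (axis i (axis j 1))) $ k $ l
          = (\<Sum>i\<in>UNIV. if i = k then \<Sum>j\<in>UNIV. if j = l then a $ i $ j else 0 else 0)"
        unfolding sum_component
        by (intro sum.cong refl) (auto simp: cmat_scale_def axis_def mult_delta_right)
      also have "\<dots> = a $ k $ l"
        by simp
      finally show "a $ k $ l
          = (\<Sum>i\<in>UNIV. \<Sum>j\<in>UNIV. cmat_scale (a $ i $ j) (axis i (axis j 1))) $ k $ l" ..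
    qed
    then have "h a = h (\<Sum>i\<in>UNIV. \<Sum>j\<in>UNIV. cmat_scale (a $ i $ j) (axis i (axis j 1)))"
      by (rule arg_cong)
    then show ?thesis
      by (simp only: sum scale)
  qed
  show "f a = g a"
    by (simp add: expand[OF f] expand[OF g] eq)
qed

text \<open>
  A real supremum bounds its terms only if they are bounded above. Here they are because \<open>T\<close> is
  bounded in the Frobenius norm, and the Frobenius and operator norms are equivalent.
\<close>

lemma contractive_opnorm_le:
  fixes T :: "'n::finite cmat \<Rightarrow> 'n cmat"
  assumes T: "clinear_map T" and "contractive T"
  shows "opnorm (T a) \<le> opnorm a"
proof -
  have lin: "linear T" by (rule clinear_map_imp_linear[OF T])
  obtain B where B: "B > 0" "\<And>a. norm (T a) \<le> B * norm a"
    using linear_bounded_pos[OF lin] by blast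
  define c where "c = (real CARD('n))\<^sup>2"
  have c: "c \<ge> 0" by (simp add: c_def)
  have bound: "opnorm (T a) \<le> c * B * c * opnorm a" for a
  proof -
    have "opnorm (T a) \<le> c * norm (T a)" unfolding c_def by (rule opnorm_le_norm)
    also have "\<dots> \<le> c * (B * norm a)" using B c by (intro mult_left_mono)
    also have "\<dots> \<le> c * (B * (c * opnorm a))"
      unfolding c_def using B by (intro mult_left_mono norm_le_opnorm) auto
    finally show ?thesis by (simp add: algebra_simps)
  qed
  show ?thesis
  proof (cases "opnorm a = 0")
    case True
    \<comment> \<open>the quotient is \<open>x / 0 = 0\<close> and says nothing about \<open>T a\<close>, but \<open>bound\<close> does\<close>
    then show ?thesis using bound[of a] by simp
  next
    case False
    then have pos: "opnorm a > 0" using opnorm_nonneg[of a] by simp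
    have "bdd_above (range (\<lambda>a. opnorm (T a) / opnorm a))"
    proof (rule bdd_aboveI2)
      fix a
      show "opnorm (T a) / opnorm a \<le> c * B * c"
        using bound[of a] opnorm_nonneg[of a] B c
        by (cases "opnorm a = 0") (simp_all add: divide_le_eq)
    qed
    then have "opnorm (T a) / opnorm a \<le> map_opnorm T"
      unfolding map_opnorm_def by (rule cSUP_upper[OF UNIV_I])
    also have "\<dots> \<le> 1" using assms(2) by (simp add: contractive_def)
    finally show ?thesis using pos by (simp add: divide_le_eq)
  qed
qed

lemma contractive_opnorm_funpow_le:
  assumes "clinear_map T" and "contractive T"
  shows "opnorm ((T ^^ k) a) \<le> opnorm a"
  by (induction k) (auto intro: order_trans[OF contractive_opnorm_le[OF assms]])

definition schur_idempotents :: "'n::finite cmat set" where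
  "schur_idempotents = {a. schur_prod a a = a}"

lemma finite_vectors_with_entries_in:
  assumes "finite A"
  shows "finite {v :: 'b^'n::finite. \<forall>i. v $ i \<in> A}"
proof (rule finite_subset)
  show "{v :: 'b^'n. \<forall>i. v $ i \<in> A} \<subseteq> vec_lambda ` (UNIV \<rightarrow>\<^sub>E A)"
  proof
    fix v :: "'b^'n" assume "v \<in> {v. \<forall>i. v $ i \<in> A}"
    then show "v \<in> vec_lambda ` (UNIV \<rightarrow>\<^sub>E A)"
      by (intro image_eqI[of _ _ "vec_nth v"]) auto
  qed
  show "finite (vec_lambda ` (UNIV \<rightarrow>\<^sub>E A) :: ('b^'n) set)"
    using assms by (intro finite_imageI finite_PiE) auto
qed

lemma finite_schur_idempotents: "finite (schur_idempotents :: 'n::finite cmat set)"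
proof -
  have "(schur_idempotents :: 'n cmat set) \<subseteq> {a. \<forall>i. a $ i \<in> {v. \<forall>j. v $ j \<in> {0, 1}}}"
    by (auto simp: schur_idempotents_def schur_prod_def vec_eq_iff)
  then show ?thesis
    by (rule finite_subset) (intro finite_vectors_with_entries_in; simp)
qed

lemma matrix_unit_schur_idempotent: "axis i (axis j 1) \<in> schur_idempotents"
  by (simp add: schur_idempotents_def schur_prod_def axis_def vec_eq_iff)

lemma schur_multiplicative_funpow_idempotent:
  assumes "schur_multiplicative T" and "a \<in> schur_idempotents"
  shows "(T ^^ k) a \<in> schur_idempotents"
  using assms by (induction k) (auto simp: schur_idempotents_def schur_multiplicative_def)

text \<open>
  The powers of \<open>T\<close>, restricted to the finite set of idempotents, are among the finitely many
  self-maps of that set, so two of them coincide; this determines the powers on the matrix units,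
  so the unrestricted powers coincide as well, and injectivity cancels the smaller one.
\<close>

lemma schur_multiplicative_inj_finite_order:
  fixes T :: "'n::finite cmat \<Rightarrow> 'n cmat"
  assumes T: "clinear_map T" and "inj T" and mult: "schur_multiplicative T"
  obtains m where "T ^^ Suc m = id"
proof -
  let ?S = "schur_idempotents :: 'n cmat set"
  define r where "r k = restrict (T ^^ k) ?S" for k
  have "range r \<subseteq> ?S \<rightarrow>\<^sub>E ?S"
    by (auto simp: r_def schur_multiplicative_funpow_idempotent[OF mult])
  then have "finite (range r)"
    by (rule finite_subset) (simp add: finite_PiE finite_schur_idempotents)
  then have "\<not> inj r"
    using finite_imageD infinite_UNIV_nat by blast
  then obtain k l where "k < l" and kl: "r k = r l"
    by (metis injI linorder_neqE_nat)
  then obtain m where l: "l = k + Suc m"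
    using less_imp_Suc_add by auto
  have "T ^^ k = T ^^ l"
  proof (rule clinear_map_eqI_units)
    show "(T ^^ k) (axis i (axis j 1)) = (T ^^ l) (axis i (axis j 1))" for i j
      using fun_cong[OF kl, of "axis i (axis j 1)"]
      by (simp add: r_def matrix_unit_schur_idempotent)
  qed (rule clinear_map_funpow[OF T])+
  then have "(T ^^ k) ((T ^^ Suc m) a) = (T ^^ k) a" for a
    unfolding l by (simp only: funpow_add comp_apply) (metis comp_apply)
  then have "T ^^ Suc m = id"
    using inj_fn[OF \<open>inj T\<close>, of k] by (auto simp: fun_eq_iff dest: injD simp del: funpow.simps)
  then show thesis by (rule that)
qed

theorem corollary2p4:
  fixes T :: "complex^'n^'n \<Rightarrow> complex^'n^'n"
  assumes "clinear_map T"
    and "surj T"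
    and "contractive T"
    and "schur_multiplicative T"
  shows "opnorm_isometry T"
proof -
  have lin: "linear T" by (rule clinear_map_imp_linear[OF assms(1)])
  have "inj T" by (rule linear_surjective_imp_injective[OF lin assms(2) refl])
  then obtain m where m: "T ^^ Suc m = id"
    using schur_multiplicative_inj_finite_order assms by blast
  have "opnorm (T c) = opnorm c" for c
  proof (rule antisym)
    show "opnorm (T c) \<le> opnorm c"
      by (rule contractive_opnorm_le[OF assms(1,3)])
    have "opnorm c = opnorm ((T ^^ m) (T c))"
      using fun_cong[OF m, of c] by (simp add: funpow_swap1)
    also have "\<dots> \<le> opnorm (T c)"
      by (rule contractive_opnorm_funpow_le[OF assms(1,3)])
    finally show "opnorm c \<le> opnorm (T c)" .
  qed
  then show ?thesis
    unfolding opnorm_isometry_def by (simp flip: linear_diff[OF lin])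
qed

end
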